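(* Consider GPDMM (defined in the context) for $\min\sum_{i=1}^m f_i(\boldsymbol{x}_i)$ s.t. $\boldsymbol{x}_s=\boldsymbol{x}_i$, $i=1,\ldots,m$, where the $f_i$ are convex (the case $\mu=0$), with parameters $\rho>0$, $\eta>0$, $K\geq 1$, and suppose that $1/\eta>L$. For $R\ge 1$ let $$\hat{\boldsymbol{x}}_i^{R}=\frac1R\sum_{r=1}^R\bar{\boldsymbol{x}}_i^{r,K}=\frac{1}{RK}\sum_{r=1}^R\sum_{k=1}^K\boldsymbol{x}_i^{r,k},\qquad \bar{\boldsymbol{\lambda}}_{i|s}^{R}=\frac1R\sum_{r=1}^R\boldsymbol{\lambda}_{i|s}^{r+1},$$ and let $\gamma_1=\min\left(\frac{1}{2L\eta^2},\frac{1/\eta-L}{2}\right)$. Then, as $R\to\infty$, $$\sum_{i=1}^m\Big[f_i(\hat{\boldsymbol{x}}_i^{R})-(\boldsymbol{\lambda}_{i|s}^{\star})^T\hat{\boldsymbol{x}}_i^{R}-f_i(\boldsymbol{x}_i^{\star})\Big]=\mathcal{O}(1/R)$$ and $$\sum_{i=1}^m\frac{\gamma_1\eta^2}{2}\,\|\bar{\boldsymbol{\lambda}}_{i|s}^{R}-\boldsymbol{\lambda}_{i|s}^{\star}\|^2=\mathcal{O}(1/R).$$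
   Context: Problem. $m\geq1$, $d\ge 1$. Each $f_i:\mathbb{R}^d\to\mathbb{R}$ ($i=1,\ldots,m$) is continuously differentiable and convex, and for a constant $L>0$ satisfies, for all $\boldsymbol{x},\boldsymbol{y}\in\mathbb{R}^d$, $f_i(\boldsymbol{y})\ge f_i(\boldsymbol{x})+\nabla f_i(\boldsymbol{x})^T(\boldsymbol{y}-\boldsymbol{x})+\frac{1}{2L}\|\nabla f_i(\boldsymbol{x})-\nabla f_i(\boldsymbol{y})\|^2$. Norms are Euclidean. Optimal solution. It is assumed that there exist $\boldsymbol{x}_s^{\star}$, $\{\boldsymbol{x}_i^{\star}\}$, $\{\boldsymbol{\lambda}_{i|s}^{\star}\}$ in $\mathbb{R}^d$ satisfying the KKT conditions $\boldsymbol{x}_i^{\star}=\boldsymbol{x}_s^{\star}$ and $\nabla f_i(\boldsymbol{x}_i^{\star})=\boldsymbol{\lambda}_{i|s}^{\star}$ for all $i$, and $\sum_{i=1}^m\boldsymbol{\lambda}_{i|s}^{\star}=0$; such a choice is fixed. GPDMM. Initialise with $\boldsymbol{x}_s^{1}\in\mathbb{R}^d$, $\boldsymbol{x}_i^{0,K}=\boldsymbol{x}_s^1$, $\boldsymbol{\lambda}_{s|i}^1=0$ for all $i$. For $r=1,2,\ldots$: each client $i$ sets $\boldsymbol{x}_i^{r,0}=\boldsymbol{x}_i^{r-1,K}$ and for $k=0,\ldots,K-1$ computes $$\boldsymbol{x}_i^{r,k+1}=\boldsymbol{x}_i^{r,k}-\frac{1}{1/\eta+\rho}\big[\nabla f_i(\boldsymbol{x}_i^{r,k})+\rho(\boldsymbol{x}_i^{r,k}-\boldsymbol{x}_s^r)+\boldsymbol{\lambda}_{s|i}^r\big];$$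 it then sets $\bar{\boldsymbol{x}}_i^{r,K}=\frac1K\sum_{k=1}^K\boldsymbol{x}_i^{r,k}$ and $\boldsymbol{\lambda}_{i|s}^{r+1}=\rho(\boldsymbol{x}_s^r-\bar{\boldsymbol{x}}_i^{r,K})-\boldsymbol{\lambda}_{s|i}^r$. The server sets $\boldsymbol{x}_s^{r+1}=\frac1m\sum_{i=1}^m(\bar{\boldsymbol{x}}_i^{r,K}-\boldsymbol{\lambda}_{i|s}^{r+1}/\rho)$ and $\boldsymbol{\lambda}_{s|i}^{r+1}=\rho(\bar{\boldsymbol{x}}_i^{r,K}-\boldsymbol{x}_s^{r+1})-\boldsymbol{\lambda}_{i|s}^{r+1}$. *)

theory Defs
  imports "HOL-Analysis.Analysis" "HOL-Library.Landau_Symbols"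
begin

text \<open>Clients are indexed by \<open>{1..m}\<close>, and \<open>g i\<close> is the gradient of \<open>f i\<close>. For convex differentiable
  \<open>f i\<close>, the last conjunct says that \<open>g i\<close> is \<open>L\<close>-Lipschitz.\<close>

definition smooth_convex_family ::
  "nat \<Rightarrow> real \<Rightarrow> (nat \<Rightarrow> 'a::euclidean_space \<Rightarrow> real) \<Rightarrow> (nat \<Rightarrow> 'a \<Rightarrow> 'a) \<Rightarrow> bool" where
  "smooth_convex_family m L f g \<longleftrightarrow> (\<forall>i\<in>{1..m}.
     (\<forall>x. GDERIV (f i) x :> g i x) \<and>
     continuous_on UNIV (g i) \<and>
     convex_on UNIV (f i) \<and>
     (\<forall>x y. f i y \<ge> f i x + g i x \<bullet> (y - x) + 1 / (2 * L) * (norm (g i x - g i y))\<^sup>2))"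

definition kkt_point ::
  "nat \<Rightarrow> (nat \<Rightarrow> 'a::euclidean_space \<Rightarrow> 'a) \<Rightarrow> 'a \<Rightarrow> (nat \<Rightarrow> 'a) \<Rightarrow> (nat \<Rightarrow> 'a) \<Rightarrow> bool" where
  "kkt_point m g xs_opt x_opt lam_opt \<longleftrightarrow>
     (\<forall>i\<in>{1..m}. x_opt i = xs_opt \<and> g i (x_opt i) = lam_opt i) \<and>
     (\<Sum>i=1..m. lam_opt i) = 0"

definition client_avg :: "nat \<Rightarrow> (nat \<Rightarrow> nat \<Rightarrow> nat \<Rightarrow> 'a::real_vector) \<Rightarrow> nat \<Rightarrow> nat \<Rightarrow> 'a" where
  "client_avg K x i r = (1 / real K) *\<^sub>R (\<Sum>k=1..K. x i r k)"

text \<open>Below, \<open>xs r\<close> is the server iterate of round \<open>r\<close>, \<open>x i r k\<close> the iterate of client \<open>i\<close> in round \<open>r\<close>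
  after \<open>k\<close> inner steps, \<open>lam_is i r\<close> the dual variable sent from client \<open>i\<close> to the server and
  \<open>lam_si i r\<close> the one sent back. Rounds start at 1. Round 0 only provides the initial value
  \<open>x i 0 K\<close>; \<open>x i 0 k\<close> for \<open>k < K\<close>, the values of \<open>xs\<close>, \<open>lam_is\<close> and \<open>lam_si\<close> at round 0, and
  \<open>lam_is i 1\<close> are unconstrained and never used.\<close>

definition gpdmm ::
  "nat \<Rightarrow> (nat \<Rightarrow> 'a::euclidean_space \<Rightarrow> 'a) \<Rightarrow> real \<Rightarrow> real \<Rightarrow> nat \<Rightarrow> (nat \<Rightarrow> 'a) \<Rightarrow>
   (nat \<Rightarrow> nat \<Rightarrow> nat \<Rightarrow> 'a) \<Rightarrow> (nat \<Rightarrow> nat \<Rightarrow> 'a) \<Rightarrow> (nat \<Rightarrow> nat \<Rightarrow> 'a) \<Rightarrow> bool" where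
  "gpdmm m g \<rho> \<eta> K xs x lam_is lam_si \<longleftrightarrow>
     (\<forall>i\<in>{1..m}. x i 0 K = xs 1 \<and> lam_si i 1 = 0) \<and>
     (\<forall>r\<ge>1.
       (\<forall>i\<in>{1..m}.
          x i r 0 = x i (r - 1) K \<and>
          (\<forall>k<K. x i r (Suc k) =
             x i r k - (1 / (1 / \<eta> + \<rho>)) *\<^sub>R
               (g i (x i r k) + \<rho> *\<^sub>R (x i r k - xs r) + lam_si i r)) \<and>
          lam_is i (Suc r) = \<rho> *\<^sub>R (xs r - client_avg K x i r) - lam_si i r) \<and>
       xs (Suc r) = (1 / real m) *\<^sub>R
         (\<Sum>i=1..m. client_avg K x i r - (1 / \<rho>) *\<^sub>R lam_is i (Suc r)) \<and>
       (\<forall>i\<in>{1..m}. lam_si i (Suc r) =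
          \<rho> *\<^sub>R (client_avg K x i r - xs (Suc r)) - lam_is i (Suc r)))"

definition primal_avg :: "nat \<Rightarrow> (nat \<Rightarrow> nat \<Rightarrow> nat \<Rightarrow> 'a::real_vector) \<Rightarrow> nat \<Rightarrow> nat \<Rightarrow> 'a" where
  "primal_avg K x i R = (1 / real R) *\<^sub>R (\<Sum>r=1..R. client_avg K x i r)"

definition dual_avg :: "(nat \<Rightarrow> nat \<Rightarrow> 'a::real_vector) \<Rightarrow> nat \<Rightarrow> nat \<Rightarrow> 'a" where
  "dual_avg lam_is i R = (1 / real R) *\<^sub>R (\<Sum>r=1..R. lam_is i (Suc r))"

definition gamma1 :: "real \<Rightarrow> real \<Rightarrow> real" where
  "gamma1 L \<eta> = min (1 / (2 * L * \<eta>\<^sup>2)) ((1 / \<eta> - L) / 2)"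

lemma primal_avg_double_sum:
  "primal_avg K x i R = (1 / (real R * real K)) *\<^sub>R (\<Sum>r=1..R. \<Sum>k=1..K. x i r k)"
  by (simp add: primal_avg_def client_avg_def scaleR_sum_right[symmetric])

text \<open>The recurrences determine a run from every starting point.\<close>

lemma gpdmm_exists:
  fixes g :: "nat \<Rightarrow> 'a::euclidean_space \<Rightarrow> 'a"
  shows "\<exists>xs x lam_is lam_si. xs 1 = x0 \<and> gpdmm m g \<rho> \<eta> K xs x lam_is lam_si"
proof -
  define inner where "inner = (\<lambda>i s l z k. ((\<lambda>y. y - (1 / (1 / \<eta> + \<rho>)) *\<^sub>R
      (g i y + \<rho> *\<^sub>R (y - s) + l)) ^^ k) (z::'a))"
  define avg where "avg = (\<lambda>i s l z. (1 / real K) *\<^sub>R (\<Sum>k=1..K. inner i s l z k))"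
  define up where "up = (\<lambda>i s l z. \<rho> *\<^sub>R (s - avg i s l z) - l)"
  define srv where "srv = (\<lambda>s l z. (1 / real m) *\<^sub>R
      (\<Sum>i=1..m. avg i s (l i) (z i) - (1 / \<rho>) *\<^sub>R up i s (l i) (z i)))"
  \<comment> \<open>state at the start of a round: server iterate, server duals, last client iterates\<close>
  define step where "step = (\<lambda>(s, l, z). (srv s l z,
      (\<lambda>i. \<rho> *\<^sub>R (avg i s (l i) (z i) - srv s l z) - up i s (l i) (z i)),
      (\<lambda>i. inner i s (l i) (z i) K)))"
  define st where "st = (\<lambda>r. (step ^^ (r - 1)) (x0, (\<lambda>i::nat. 0::'a), (\<lambda>i::nat. x0)))"
  define xs where "xs = (\<lambda>r. fst (st r))"
  define lsi where "lsi = (\<lambda>i r. fst (snd (st r)) i)"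
  define z where "z = (\<lambda>i r. snd (snd (st r)) i)"
  define x where "x = (\<lambda>i r k. if r = 0 then x0 else inner i (xs r) (lsi i r) (z i r) k)"
  define lis where "lis = (\<lambda>i r. up i (xs (r - 1)) (lsi i (r - 1)) (z i (r - 1)))"
  have st1: "st 1 = (x0, (\<lambda>i. 0), (\<lambda>i. x0))" by (simp add: st_def)
  have stS: "st (Suc r) = step (st r)" if "r \<ge> 1" for r
    using that by (cases r) (auto simp: st_def)
  have step': "step t = (srv (fst t) (fst (snd t)) (snd (snd t)),
      (\<lambda>i. \<rho> *\<^sub>R (avg i (fst t) (fst (snd t) i) (snd (snd t) i) - srv (fst t) (fst (snd t)) (snd (snd t)))
         - up i (fst t) (fst (snd t) i) (snd (snd t) i)),
      (\<lambda>i. inner i (fst t) (fst (snd t) i) (snd (snd t) i) K))" for t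
    by (cases t) (simp add: step_def)
  have av: "client_avg K x i r = avg i (xs r) (lsi i r) (z i r)" if "r \<ge> 1" for i r
    using that by (simp add: client_avg_def avg_def x_def)
  have zx: "z i r = x i (r - 1) K" if "r \<ge> 1" for i r
  proof (cases "r = 1")
    case True
    then show ?thesis by (simp add: z_def x_def st_def)
  next
    case False
    define q where "q = r - 1"
    have "r = Suc q" "q \<ge> 1" using that False by (auto simp: q_def)
    then show ?thesis by (simp add: z_def x_def stS step' xs_def lsi_def)
  qed
  have "gpdmm m g \<rho> \<eta> K xs x lis lsi"
    unfolding gpdmm_def
  proof (intro conjI allI ballI impI)
    fix i show "x i 0 K = xs 1" "lsi i 1 = 0"
      using st1 by (simp_all add: x_def xs_def lsi_def)
  next
    fix r i :: nat assume r: "1 \<le> r"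
    have "x i r 0 = z i r" using r by (simp add: x_def inner_def)
    then show "x i r 0 = x i (r - 1) K" using zx[OF r] by simp
  next
    fix r i k :: nat assume r: "1 \<le> r"
    show "x i r (Suc k) = x i r k - (1 / (1 / \<eta> + \<rho>)) *\<^sub>R
               (g i (x i r k) + \<rho> *\<^sub>R (x i r k - xs r) + lsi i r)"
      using r by (simp add: x_def inner_def)
  next
    fix r i :: nat assume r: "1 \<le> r"
    show "lis i (Suc r) = \<rho> *\<^sub>R (xs r - client_avg K x i r) - lsi i r"
      using r by (simp add: lis_def up_def av)
  next
    fix r :: nat assume r: "1 \<le> r"
    show "xs (Suc r) = (1 / real m) *\<^sub>R
         (\<Sum>i=1..m. client_avg K x i r - (1 / \<rho>) *\<^sub>R lis i (Suc r))"
      using r by (simp add: av) (simp add: xs_def stS step' srv_def lis_def lsi_def z_def)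
  next
    fix r i :: nat assume r: "1 \<le> r"
    show "lsi i (Suc r) = \<rho> *\<^sub>R (client_avg K x i r - xs (Suc r)) - lis i (Suc r)"
      using r by (simp add: av) (simp add: xs_def stS step' lis_def lsi_def z_def)
  qed
  moreover have "xs 1 = x0" using st1 by (simp add: xs_def)
  ultimately show ?thesis by blast
qed

end

theory Submission
  imports Defs
begin

text \<open>Put \<open>D i y = f i y - f i z - lam i \<bullet> (y - z)\<close>, where \<open>z\<close> is the common optimum and \<open>lam i\<close> the gradient of
  \<open>f i\<close> there; \<open>D i \<ge> 0\<close> by convexity. An inner step satisfies
  \<open>p = g i y + (1/\<eta>) (y' - y)\<close> with \<open>p = \<rho> (xs - y') - lam_si\<close>, and smoothness bounds
  \<open>D i y'\<close> plus a multiple of \<open>\<parallel>p - lam i\<parallel>\<^sup>2\<close> by a telescoping term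
  plus \<open>(p - lam i) \<bullet> (y' - z)\<close>. Averaged over the inner steps, the latter is at most
  \<open>(lam_is - lam i) \<bullet> (avg - z)\<close>, since it is concave in \<open>y'\<close>. Summed over the clients, this telescopes too:
  it is the difference of \<open>\<parallel>\<rho> xs - lam_si - (\<rho> z + lam i)\<parallel>\<^sup>2 / (4 \<rho>)\<close> between two rounds, because
  the server step is a reflection (Peaceman--Rachford splitting). So both quantities are summable over
  the rounds, and Jensen's inequality transfers the bound to the averages.\<close>

section \<open>Jensen's inequality and estimates for squared norms\<close>

lemma convex_on_mean:
  fixes y :: "nat \<Rightarrow> 'a::real_vector"
  assumes "convex_on UNIV F" "n \<ge> 1"
  shows "F ((1 / real n) *\<^sub>R (\<Sum>k=1..n. y k)) \<le> (1 / real n) * (\<Sum>k=1..n. F (y k))"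
proof -
  have "F (\<Sum>k=1..n. (1 / real n) *\<^sub>R y k) \<le> (\<Sum>k=1..n. (1 / real n) * F (y k))"
    using assms by (intro convex_on_sum) auto
  then show ?thesis
    by (simp add: scaleR_sum_right sum_distrib_left)
qed

lemma convex_on_norm_power2: "convex_on UNIV (\<lambda>x::'a::real_inner. (norm x)\<^sup>2)"
proof (intro convex_onI)
  fix t :: real and x y :: 'a
  assume t: "0 < t" "t < 1"
  have "(1 - t) * (norm x)\<^sup>2 + t * (norm y)\<^sup>2 - (norm ((1 - t) *\<^sub>R x + t *\<^sub>R y))\<^sup>2
      = t * (1 - t) * (norm (x - y))\<^sup>2"
    unfolding power2_norm_eq_inner by (simp add: inner_simps inner_commute algebra_simps)
  moreover have "0 \<le> t * (1 - t) * (norm (x - y))\<^sup>2" using t by simp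
  ultimately show "(norm ((1 - t) *\<^sub>R x + t *\<^sub>R y))\<^sup>2 \<le> (1 - t) * (norm x)\<^sup>2 + t * (norm y)\<^sup>2"
    by linarith
qed simp

lemma norm_add_power2_le:
  fixes a b :: "'a::real_inner"
  shows "(norm (a + b))\<^sup>2 \<le> 2 * (norm a)\<^sup>2 + 2 * (norm b)\<^sup>2"
proof -
  have "2 * (norm a)\<^sup>2 + 2 * (norm b)\<^sup>2 - (norm (a + b))\<^sup>2 = (norm (a - b))\<^sup>2"
    by (simp add: power2_norm_eq_inner inner_simps inner_commute)
  then show ?thesis using zero_le_power2[of "norm (a - b)"] by linarith
qed

text \<open>Young's inequality, by completing the square. The weights are those for which the first
  term cancels the quadratic term of the smoothness assumption in
  \<open>descent_step\<close>.\<close>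

lemma inner_le_weighted:
  fixes a b :: "'a::real_inner"
  assumes "L > 0"
  shows "a \<bullet> b \<le> 1 / (2 * L) * (norm a)\<^sup>2 + L / 2 * (norm b)\<^sup>2"
proof -
  have "1 / (2 * L) * (norm a)\<^sup>2 + L / 2 * (norm b)\<^sup>2 - a \<bullet> b = 1 / (2 * L) * (norm (a - L *\<^sub>R b))\<^sup>2"
    using assms unfolding power2_norm_eq_inner
    by (simp add: inner_simps inner_commute field_simps)
  moreover have "0 \<le> 1 / (2 * L) * (norm (a - L *\<^sub>R b))\<^sup>2" using assms by simp
  ultimately show ?thesis by linarith
qed

section \<open>A single inner step and its average over a round\<close>

text \<open>Moving from \<open>y\<close> to \<open>y'\<close> costs \<open>L / 2\<close> times the
  squared step length, the three-point identity returns \<open>1 / (2 * \<eta>)\<close> times it,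
  and comparing \<open>y\<close> with \<open>z\<close> leaves \<open>1 / (2 * L)\<close> times the
  squared gradient gap. What is left over pays for the term in \<open>p - g z\<close>.\<close>

lemma descent_step:
  fixes f :: "'a::real_inner \<Rightarrow> real" and g :: "'a \<Rightarrow> 'a"
  assumes L: "L > 0" and \<eta>: "\<eta> > 0" "1 / \<eta> > L"
    and coco: "\<And>x y. f y \<ge> f x + g x \<bullet> (y - x) + 1 / (2 * L) * (norm (g x - g y))\<^sup>2"
    and p: "p = g y + (1 / \<eta>) *\<^sub>R (y' - y)"
  shows "f y' - f z - g z \<bullet> (y' - z) + gamma1 L \<eta> * \<eta>\<^sup>2 / 2 * (norm (p - g z))\<^sup>2
    \<le> 1 / (2 * \<eta>) * ((norm (y - z))\<^sup>2 - (norm (y' - z))\<^sup>2) + (p - g z) \<bullet> (y' - z)"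
proof -
  define G where "G = gamma1 L \<eta>"
  have G: "0 \<le> G" "G \<le> 1 / (2 * L * \<eta>\<^sup>2)" "G \<le> (1 / \<eta> - L) / 2"
    unfolding G_def gamma1_def using L \<eta> by (simp_all only: min.cobounded1 min.cobounded2) simp
  let ?A = "(norm (g y - g z))\<^sup>2" and ?B = "(norm (y' - y))\<^sup>2"
  \<comment> \<open>The descent lemma, obtained from \<open>coco\<close> based at \<open>y'\<close>:
    replacing \<open>g y'\<close> by \<open>g y\<close> costs an inner product that Young's
    inequality splits, and the gradient part cancels.\<close>
  have smooth: "f y' \<le> f y + g y \<bullet> (y' - y) + L / 2 * ?B"
  proof -
    have "f y \<ge> f y' + g y' \<bullet> (y - y') + 1 / (2 * L) * (norm (g y' - g y))\<^sup>2" by (rule coco)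
    moreover have "(g y' - g y) \<bullet> (y' - y) \<le> 1 / (2 * L) * (norm (g y' - g y))\<^sup>2 + L / 2 * ?B"
      using L by (rule inner_le_weighted)
    ultimately show ?thesis by (simp add: inner_diff_left inner_diff_right)
  qed
  have opt: "f z \<ge> f y + g y \<bullet> (z - y) + 1 / (2 * L) * ?A" by (rule coco)
  have three: "(1 / \<eta>) * ((y' - y) \<bullet> (y' - z))
      = 1 / (2 * \<eta>) * ((norm (y' - z))\<^sup>2 - (norm (y - z))\<^sup>2 + ?B)"
    using \<eta> by (simp add: power2_norm_eq_inner inner_simps inner_commute field_simps)
  have "g y = p - (1 / \<eta>) *\<^sub>R (y' - y)" using p by simp
  then have gp: "g y \<bullet> (y' - z) = p \<bullet> (y' - z) - (1 / \<eta>) * ((y' - y) \<bullet> (y' - z))"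
    by (simp add: inner_diff_left)
  have "(norm (p - g z))\<^sup>2 \<le> 2 * ?A + 2 * (norm ((1 / \<eta>) *\<^sub>R (y' - y)))\<^sup>2"
    using norm_add_power2_le[of "g y - g z" "(1 / \<eta>) *\<^sub>R (y' - y)"]
    by (simp only: p diff_add_eq[symmetric])
  also have "\<dots> = 2 * ?A + 2 * (?B / \<eta>\<^sup>2)" by (simp add: power_divide power_mult_distrib)
  finally have "G * \<eta>\<^sup>2 / 2 * (norm (p - g z))\<^sup>2 \<le> G * \<eta>\<^sup>2 / 2 * (2 * ?A + 2 * (?B / \<eta>\<^sup>2))"
    using G by (intro mult_left_mono) auto
  also have "\<dots> = G * \<eta>\<^sup>2 * ?A + G * ?B" using \<eta> by (simp add: field_simps)
  \<comment> \<open>Each argument of the minimum in \<open>gamma1\<close> controls one coefficient: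
    the first that of \<open>?A\<close>, the second that of \<open>?B\<close>.\<close>
  also have "\<dots> \<le> 1 / (2 * L) * ?A + (1 / \<eta> - L) / 2 * ?B"
  proof (intro add_mono mult_right_mono)
    have "G * \<eta>\<^sup>2 \<le> 1 / (2 * L * \<eta>\<^sup>2) * \<eta>\<^sup>2" using G by (intro mult_right_mono) auto
    then show "G * \<eta>\<^sup>2 \<le> 1 / (2 * L)" using \<eta> by simp
  qed (use G in auto)
  finally have "G * \<eta>\<^sup>2 / 2 * (norm (p - g z))\<^sup>2 \<le> 1 / (2 * L) * ?A + (1 / \<eta> - L) / 2 * ?B" .
  moreover have "(1 / \<eta> - L) / 2 * ?B = 1 / (2 * \<eta>) * ?B - L / 2 * ?B"
    by (simp add: field_simps)
  moreover have "g y \<bullet> (y' - z) = g y \<bullet> (y' - y) - g y \<bullet> (z - y)"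
    by (simp add: inner_diff_right)
  moreover have "(p - g z) \<bullet> (y' - z) = p \<bullet> (y' - z) - g z \<bullet> (y' - z)"
    by (rule inner_diff_left)
  ultimately show ?thesis
    using smooth opt three gp unfolding G_def[symmetric] distrib_left right_diff_distrib
    by linarith
qed

text \<open>The dual update is affine in the primal point, so \<open>lam\<close> is the mean of the
  vectors obtained by inserting each inner iterate in place of \<open>ya\<close>. The bounds of
  \<open>descent_step\<close> for these vectors can therefore be averaged with Jensen's
  inequality.\<close>

lemma client_round:
  fixes f :: "'a::real_inner \<Rightarrow> real" and g :: "'a \<Rightarrow> 'a" and y :: "nat \<Rightarrow> 'a"
  assumes L: "L > 0" and \<rho>: "\<rho> > 0" and \<eta>: "\<eta> > 0" "1 / \<eta> > L" and K: "K \<ge> 1"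
    and conv: "convex_on UNIV f"
    and coco: "\<And>x y. f y \<ge> f x + g x \<bullet> (y - x) + 1 / (2 * L) * (norm (g x - g y))\<^sup>2"
    and step: "\<And>k. k < K \<Longrightarrow> y (Suc k) =
      y k - (1 / (1 / \<eta> + \<rho>)) *\<^sub>R (g (y k) + \<rho> *\<^sub>R (y k - s) + l)"
    and avg: "ya = (1 / real K) *\<^sub>R (\<Sum>k=1..K. y k)"
    and lam: "lam = \<rho> *\<^sub>R (s - ya) - l"
  shows "f ya - f z - g z \<bullet> (ya - z) + gamma1 L \<eta> * \<eta>\<^sup>2 / 2 * (norm (lam - g z))\<^sup>2
    \<le> 1 / (2 * \<eta> * real K) * ((norm (y 0 - z))\<^sup>2 - (norm (y K - z))\<^sup>2) + (lam - g z) \<bullet> (ya - z)"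
proof -
  define w where "w = gamma1 L \<eta> * \<eta>\<^sup>2 / 2"
  have w: "w \<ge> 0" using L \<eta> by (simp add: w_def gamma1_def)
  \<comment> \<open>The dual vector that the update would return if \<open>y k\<close> stood in
    place of the mean \<open>ya\<close>.\<close>
  define p where "p k = \<rho> *\<^sub>R (s - y k) - l" for k
  define mean where "mean h = (1 / real K) * (\<Sum>k=1..K. h k)" for h :: "nat \<Rightarrow> real"
  have mean_add: "mean (\<lambda>k. a k + b k) = mean a + mean b" for a b
    by (simp add: mean_def sum.distrib distrib_left)
  have mean_diff: "mean (\<lambda>k. a k - b k) = mean a - mean b" for a b
    by (simp add: mean_def sum_subtractf right_diff_distrib)
  have mean_cmult: "mean (\<lambda>k. c * a k) = c * mean a" for a c
    by (simp add: mean_def sum_distrib_left[symmetric])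
  have mean_const: "mean (\<lambda>k. c) = c" for c
    using K by (simp add: mean_def)
  have mean_inner: "mean (\<lambda>k. c \<bullet> y k) = c \<bullet> ya" for c
    by (simp add: mean_def avg inner_sum_right)
  have shifted: "ya - z = (1 / real K) *\<^sub>R (\<Sum>k=1..K. y k - z)"
    using K by (simp add: avg sum_subtractf scaleR_diff_right sum_constant_scaleR)
  have lam_p: "lam - g z = (1 / real K) *\<^sub>R (\<Sum>k=1..K. p k - g z)"
    using K by (simp add: lam avg p_def sum_subtractf scaleR_diff_right
        scaleR_sum_right[symmetric] sum_constant_scaleR mult.commute)
  have inner_step: "f (y k) - f z - g z \<bullet> (y k - z) + w * (norm (p k - g z))\<^sup>2
      \<le> 1 / (2 * \<eta>) * ((norm (y (k - 1) - z))\<^sup>2 - (norm (y k - z))\<^sup>2) + (p k - g z) \<bullet> (y k - z)"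
    if k: "k \<in> {1..K}" for k
  proof -
    obtain j where j: "k = Suc j" "j < K" using k by (cases k) auto
    define h where "h = 1 / \<eta> + \<rho>"
    have h: "h > 0" using \<eta> \<rho> by (simp add: h_def add_pos_pos)
    have "h *\<^sub>R (y (Suc j) - y j) = - (g (y j) + \<rho> *\<^sub>R (y j - s) + l)"
      using step[OF j(2)] h by (simp add: h_def[symmetric])
    \<comment> \<open>Moving the \<rho> part of the step to the right evaluates the penalty at the
      new iterate \<open>y k\<close> instead of \<open>y j\<close>. This implicit form of the step
      is what \<open>descent_step\<close> requires of \<open>p k\<close>.\<close>
    then have scaled: "(1 / \<eta>) *\<^sub>R (y k - y j) = - (g (y j) + \<rho> *\<^sub>R (y j - s) + l) - \<rho> *\<^sub>R (y k - y j)"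
      unfolding j(1) h_def scaleR_left_distrib by (simp only: eq_diff_eq)
    have "p k = g (y j) + (1 / \<eta>) *\<^sub>R (y k - y j)"
      unfolding p_def scaled by (simp add: algebra_simps)
    from descent_step[where f = f, OF L \<eta> coco this, of z] show ?thesis by (simp add: j w_def)
  qed
  \<comment> \<open>Jensen for \<open>f\<close> and for the squared norm; the linear term is not
    affected by averaging.\<close>
  have "f ya - f z - g z \<bullet> (ya - z) + w * (norm (lam - g z))\<^sup>2
      \<le> mean (\<lambda>k. f (y k)) - f z - g z \<bullet> (ya - z) + w * mean (\<lambda>k. (norm (p k - g z))\<^sup>2)"
    using convex_on_mean[OF conv K, of y] convex_on_mean[OF convex_on_norm_power2 K, of "\<lambda>k. p k - g z"] w
    unfolding avg[symmetric] lam_p[symmetric] mean_def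
    by (intro add_mono diff_mono mult_left_mono) auto
  also have "\<dots> = mean (\<lambda>k. f (y k) - f z - g z \<bullet> (y k - z) + w * (norm (p k - g z))\<^sup>2)"
    by (simp add: mean_add mean_diff mean_cmult mean_const mean_inner inner_diff_right)
  also have "\<dots> \<le> mean (\<lambda>k. 1 / (2 * \<eta>) * ((norm (y (k - 1) - z))\<^sup>2 - (norm (y k - z))\<^sup>2)
      + (p k - g z) \<bullet> (y k - z))"
    unfolding mean_def by (intro mult_left_mono sum_mono inner_step) auto
  also have "\<dots> = 1 / (2 * \<eta> * real K) * ((norm (y 0 - z))\<^sup>2 - (norm (y K - z))\<^sup>2)
      + mean (\<lambda>k. (p k - g z) \<bullet> (y k - z))"
  proof -
    have "(\<Sum>k=1..K. (norm (y (k - 1) - z))\<^sup>2 - (norm (y k - z))\<^sup>2)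
        = (norm (y 0 - z))\<^sup>2 - (norm (y K - z))\<^sup>2"
      by (induction K) auto
    then show ?thesis by (simp only: mean_add mean_cmult) (simp add: mean_def)
  qed
  also have "mean (\<lambda>k. (p k - g z) \<bullet> (y k - z)) \<le> (lam - g z) \<bullet> (ya - z)"
  proof -
    \<comment> \<open>\<open>c\<close> is the value of \<open>p k - g z\<close> at
      \<open>y k = z\<close>, so \<open>p k - g z = c - \<rho> *\<^sub>R (y k - z)\<close>, and
      likewise for \<open>lam\<close> and \<open>ya\<close>. Both pairings are the same concave
      quadratic, evaluated at \<open>y k\<close> and at \<open>ya\<close>.\<close>
    define c where "c = \<rho> *\<^sub>R (s - z) - l - g z"
    have "(p k - g z) \<bullet> (y k - z) = c \<bullet> y k - c \<bullet> z - \<rho> * (norm (y k - z))\<^sup>2" for k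
      by (simp add: p_def c_def power2_norm_eq_inner inner_simps inner_commute algebra_simps)
    then have "mean (\<lambda>k. (p k - g z) \<bullet> (y k - z))
        = c \<bullet> ya - c \<bullet> z - \<rho> * mean (\<lambda>k. (norm (y k - z))\<^sup>2)"
      by (simp add: mean_diff mean_cmult mean_const mean_inner)
    also have "\<dots> \<le> c \<bullet> ya - c \<bullet> z - \<rho> * (norm (ya - z))\<^sup>2"
      using convex_on_mean[OF convex_on_norm_power2 K, of "\<lambda>k. y k - z"] \<rho>
      unfolding shifted[symmetric] mean_def[symmetric] by (intro diff_left_mono mult_left_mono) auto
    also have "\<dots> = (lam - g z) \<bullet> (ya - z)"
      by (simp add: lam c_def power2_norm_eq_inner inner_simps inner_commute algebra_simps)
    finally show ?thesis .
  qed
  finally show ?thesis unfolding w_def by simp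
qed

section \<open>The server step as an isometry\<close>

text \<open>For nonempty \<open>I\<close>, \<open>c\<close> is the mean of the family. Subtracting
  it twice reverses the component along the constant families and keeps the orthogonal one, so it is
  a reflection of the product space.\<close>

lemma sum_norm_power2_reflection:
  fixes v :: "'i \<Rightarrow> 'a::real_inner"
  assumes "finite I" and "real (card I) *\<^sub>R c = (\<Sum>i\<in>I. v i)"
  shows "(\<Sum>i\<in>I. (norm (v i - 2 *\<^sub>R c))\<^sup>2) = (\<Sum>i\<in>I. (norm (v i))\<^sup>2)"
proof -
  have "(norm (v i - 2 *\<^sub>R c))\<^sup>2 = (norm (v i))\<^sup>2 - 4 * (v i \<bullet> c) + 4 * (c \<bullet> c)" for i
    by (simp add: power2_norm_eq_inner inner_simps inner_commute)
  then have "(\<Sum>i\<in>I. (norm (v i - 2 *\<^sub>R c))\<^sup>2)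
      = (\<Sum>i\<in>I. (norm (v i))\<^sup>2) - 4 * ((\<Sum>i\<in>I. v i) \<bullet> c) + 4 * (real (card I) * (c \<bullet> c))"
    by (simp add: sum.distrib sum_subtractf inner_sum_left sum_distrib_left)
  also have "(\<Sum>i\<in>I. v i) \<bullet> c = real (card I) * (c \<bullet> c)"
    unfolding assms(2)[symmetric] by simp
  finally show ?thesis by simp
qed

text \<open>Polarization writes each inner product as a difference of two squares, those of
  \<open>a + \<rho> *\<^sub>R b\<close> and \<open>a - \<rho> *\<^sub>R b\<close> with
  \<open>a = lam i - lam_opt i\<close> and \<open>b = ya i - z\<close>. The first vector is the old
  state relative to its optimal value; the second is carried to the new one by the
  reflection.\<close>

lemma server_round:
  fixes ya lam l l' lam_opt :: "nat \<Rightarrow> 'a::real_inner"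
  assumes m: "m \<ge> 1" and \<rho>: "\<rho> > 0" and opt: "(\<Sum>i=1..m. lam_opt i) = 0"
    and lam: "\<And>i. i \<in> {1..m} \<Longrightarrow> lam i = \<rho> *\<^sub>R (s - ya i) - l i"
    and s': "s' = (1 / real m) *\<^sub>R (\<Sum>i=1..m. ya i - (1 / \<rho>) *\<^sub>R lam i)"
    and l': "\<And>i. i \<in> {1..m} \<Longrightarrow> l' i = \<rho> *\<^sub>R (ya i - s') - lam i"
  shows "(\<Sum>i=1..m. (lam i - lam_opt i) \<bullet> (ya i - z))
    = 1 / (4 * \<rho>) * ((\<Sum>i=1..m. (norm (\<rho> *\<^sub>R s - l i - (\<rho> *\<^sub>R z + lam_opt i)))\<^sup>2)
                 - (\<Sum>i=1..m. (norm (\<rho> *\<^sub>R s' - l' i - (\<rho> *\<^sub>R z + lam_opt i)))\<^sup>2))"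
proof -
  define v where "v i = lam i - lam_opt i - \<rho> *\<^sub>R (ya i - z)" for i
  define c where "c = - (\<rho> *\<^sub>R (s' - z))"
  have "real m *\<^sub>R s' = (\<Sum>i=1..m. ya i - (1 / \<rho>) *\<^sub>R lam i)" using m s' by simp
  then have "\<rho> *\<^sub>R (real m *\<^sub>R s') = \<rho> *\<^sub>R (\<Sum>i=1..m. ya i - (1 / \<rho>) *\<^sub>R lam i)" by simp
  also have "\<dots> = (\<Sum>i=1..m. \<rho> *\<^sub>R ya i - lam i)"
    using \<rho> by (simp add: scaleR_sum_right scaleR_diff_right)
  finally have ms: "real m *\<^sub>R (\<rho> *\<^sub>R s') = (\<Sum>i=1..m. \<rho> *\<^sub>R ya i - lam i)"
    by (simp add: mult.commute)
  \<comment> \<open>The sum of the optimal multipliers vanishes, so the mean of \<open>v\<close>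
    depends only on \<open>s' - z\<close>.\<close>
  have c: "real (card {1..m}) *\<^sub>R c = (\<Sum>i=1..m. v i)"
  proof -
    have "(\<Sum>i=1..m. v i) = (\<Sum>i=1..m. \<rho> *\<^sub>R z) - (\<Sum>i=1..m. \<rho> *\<^sub>R ya i - lam i) - (\<Sum>i=1..m. lam_opt i)"
      unfolding sum_subtractf[symmetric] by (intro sum.cong) (auto simp: v_def algebra_simps)
    also have "\<dots> = real m *\<^sub>R c"
      unfolding opt ms[symmetric] c_def
      by (simp add: scaleR_diff_right sum_constant_scaleR)
    finally show ?thesis by simp
  qed
  have "(\<Sum>i=1..m. (norm (\<rho> *\<^sub>R s' - l' i - (\<rho> *\<^sub>R z + lam_opt i)))\<^sup>2) = (\<Sum>i=1..m. (norm (v i - 2 *\<^sub>R c))\<^sup>2)"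
  proof (rule sum.cong)
    fix i assume "i \<in> {1..m}"
    then have "\<rho> *\<^sub>R s' - l' i - (\<rho> *\<^sub>R z + lam_opt i) = v i - 2 *\<^sub>R c"
      unfolding v_def c_def scaleR_2 by (simp add: l' scaleR_diff_right)
    then show "(norm (\<rho> *\<^sub>R s' - l' i - (\<rho> *\<^sub>R z + lam_opt i)))\<^sup>2 = (norm (v i - 2 *\<^sub>R c))\<^sup>2" by simp
  qed simp
  also have "\<dots> = (\<Sum>i=1..m. (norm (v i))\<^sup>2)"
    using c by (intro sum_norm_power2_reflection) auto
  finally have next_round: "(\<Sum>i=1..m. (norm (\<rho> *\<^sub>R s' - l' i - (\<rho> *\<^sub>R z + lam_opt i)))\<^sup>2)
      = (\<Sum>i=1..m. (norm (v i))\<^sup>2)" .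
  have polar: "(lam i - lam_opt i) \<bullet> (ya i - z) = 1 / (4 * \<rho>) *
      ((norm (\<rho> *\<^sub>R s - l i - (\<rho> *\<^sub>R z + lam_opt i)))\<^sup>2 - (norm (v i))\<^sup>2)" if "i \<in> {1..m}" for i
  proof -
    define a b where "a = lam i - lam_opt i" and "b = ya i - z"
    have "\<rho> *\<^sub>R s - l i - (\<rho> *\<^sub>R z + lam_opt i) = a + \<rho> *\<^sub>R b"
      using lam[OF that] by (simp add: a_def b_def algebra_simps)
    moreover have "v i = a - \<rho> *\<^sub>R b" by (simp add: v_def a_def b_def)
    moreover have "a \<bullet> b = 1 / (4 * \<rho>) * ((norm (a + \<rho> *\<^sub>R b))\<^sup>2 - (norm (a - \<rho> *\<^sub>R b))\<^sup>2)"
      using \<rho> by (simp add: power2_norm_eq_inner inner_simps inner_commute field_simps)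
    ultimately show ?thesis unfolding a_def[symmetric] b_def[symmetric] by (simp only:)
  qed
  show ?thesis
    unfolding next_round sum_subtractf[symmetric] sum_distrib_left by (rule sum.cong[OF refl polar])
qed

section \<open>From bounded sums to the rate\<close>

lemma bigo_inverse_natI:
  fixes q :: "nat \<Rightarrow> real"
  assumes "\<And>R. R \<ge> 1 \<Longrightarrow> 0 \<le> q R" and "\<And>R. R \<ge> 1 \<Longrightarrow> real R * q R \<le> C"
  shows "q \<in> O(\<lambda>R. 1 / real R)"
proof (rule bigoI)
  show "eventually (\<lambda>R. norm (q R) \<le> C * norm (1 / real R)) at_top"
    using eventually_ge_at_top[of 1]
  proof eventually_elim
    case (elim R)
    then show ?case using assms[of R] by (simp add: field_simps)
  qed
qed

theorem theorem2:
  fixes m K :: nat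
    and L \<rho> \<eta> :: real
    and f :: "nat \<Rightarrow> real ^ 'd \<Rightarrow> real"
    and g :: "nat \<Rightarrow> real ^ 'd \<Rightarrow> real ^ 'd"
    and xs_opt :: "real ^ 'd"
    and x_opt lam_opt :: "nat \<Rightarrow> real ^ 'd"
    and xs :: "nat \<Rightarrow> real ^ 'd"
    and x :: "nat \<Rightarrow> nat \<Rightarrow> nat \<Rightarrow> real ^ 'd"
    and lam_is lam_si :: "nat \<Rightarrow> nat \<Rightarrow> real ^ 'd"
  assumes "m \<ge> 1" and "K \<ge> 1"
    and "L > 0" and "\<rho> > 0" and "\<eta> > 0" and "1 / \<eta> > L"
    and "smooth_convex_family m L f g"
    and "kkt_point m g xs_opt x_opt lam_opt"
    and "gpdmm m g \<rho> \<eta> K xs x lam_is lam_si"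
  shows "(\<lambda>R. \<Sum>i=1..m. f i (primal_avg K x i R) - lam_opt i \<bullet> primal_avg K x i R - f i (x_opt i))
           \<in> O(\<lambda>R. 1 / real R) \<and>
         (\<lambda>R. \<Sum>i=1..m. gamma1 L \<eta> * \<eta>\<^sup>2 / 2 * (norm (dual_avg lam_is i R - lam_opt i))\<^sup>2)
           \<in> O(\<lambda>R. 1 / real R)"
proof -
  note pos = \<open>L > 0\<close> \<open>\<rho> > 0\<close> \<open>\<eta> > 0\<close> \<open>1 / \<eta> > L\<close>
  define z where "z = xs_opt"
  define w where "w = gamma1 L \<eta> * \<eta>\<^sup>2 / 2"
  have w: "w \<ge> 0" using pos by (simp add: w_def gamma1_def)
  have conv: "convex_on UNIV (f i)" if "i \<in> {1..m}" for i
    using assms(7) that by (auto simp: smooth_convex_family_def)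
  have coco: "f i b \<ge> f i a + g i a \<bullet> (b - a) + 1 / (2 * L) * (norm (g i a - g i b))\<^sup>2"
    if "i \<in> {1..m}" for i a b
    using assms(7) that by (auto simp: smooth_convex_family_def)
  have opt: "x_opt i = z" "lam_opt i = g i z" if "i \<in> {1..m}" for i
    using assms(8) that unfolding kkt_point_def z_def by metis+
  have opt_sum: "(\<Sum>i=1..m. lam_opt i) = 0"
    using assms(8) by (simp add: kkt_point_def)

  \<comment> \<open>\<open>D i\<close> is the Bregman distance of \<open>f i\<close> to
    \<open>z\<close>. Nonnegativity of \<open>D\<close> and \<open>N\<close> serves twice: it
    separates the two bounds, and it turns upper bounds into bounds on absolute values.\<close>
  define D where "D i y = f i y - f i z - lam_opt i \<bullet> (y - z)" for i y
  define N where "N i l = w * (norm (l - lam_opt i))\<^sup>2" for i l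
  have D_nonneg: "D i y \<ge> 0" if "i \<in> {1..m}" for i y
  proof -
    have "0 \<le> 1 / (2 * L) * (norm (g i z - g i y))\<^sup>2" using pos by simp
    then show ?thesis using coco[OF that, where a = z and b = y] opt[OF that] by (simp add: D_def)
  qed
  have N_nonneg: "N i l \<ge> 0" for i l using w by (simp add: N_def)

  \<comment> \<open>Lyapunov function: the first sum collects the client distances, the second the
    server states. The distances chain across rounds because a client restarts from its last
    iterate, \<open>x i (Suc r) 0 = x i r K\<close>.\<close>
  define \<Phi> where "\<Phi> r = (\<Sum>i=1..m. 1 / (2 * \<eta> * real K) * (norm (x i r 0 - z))\<^sup>2)
    + 1 / (4 * \<rho>) * (\<Sum>i=1..m. (norm (\<rho> *\<^sub>R xs r - lam_si i r - (\<rho> *\<^sub>R z + lam_opt i)))\<^sup>2)" for r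
  have \<Phi>_nonneg: "\<Phi> r \<ge> 0" for r
    unfolding \<Phi>_def using pos by (intro add_nonneg_nonneg mult_nonneg_nonneg sum_nonneg) auto

  have round: "(\<Sum>i=1..m. D i (client_avg K x i r) + N i (lam_is i (Suc r))) \<le> \<Phi> r - \<Phi> (Suc r)"
    if r: "r \<ge> 1" for r
  proof -
    have run: "x i (Suc r) 0 = x i r K"
      "\<And>k. k < K \<Longrightarrow> x i r (Suc k) = x i r k - (1 / (1 / \<eta> + \<rho>)) *\<^sub>R
               (g i (x i r k) + \<rho> *\<^sub>R (x i r k - xs r) + lam_si i r)"
      "lam_is i (Suc r) = \<rho> *\<^sub>R (xs r - client_avg K x i r) - lam_si i r"
      "lam_si i (Suc r) = \<rho> *\<^sub>R (client_avg K x i r - xs (Suc r)) - lam_is i (Suc r)"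
      if "i \<in> {1..m}" for i
      using assms(9) that r unfolding gpdmm_def by auto
    have server: "xs (Suc r) = (1 / real m) *\<^sub>R
         (\<Sum>i=1..m. client_avg K x i r - (1 / \<rho>) *\<^sub>R lam_is i (Suc r))"
      using assms(9) r unfolding gpdmm_def by blast
    have "(\<Sum>i=1..m. D i (client_avg K x i r) + N i (lam_is i (Suc r)))
      \<le> (\<Sum>i=1..m. 1 / (2 * \<eta> * real K) * ((norm (x i r 0 - z))\<^sup>2 - (norm (x i (Suc r) 0 - z))\<^sup>2)
          + (lam_is i (Suc r) - lam_opt i) \<bullet> (client_avg K x i r - z))"
    proof (rule sum_mono)
      fix i assume i: "i \<in> {1..m}"
      show "D i (client_avg K x i r) + N i (lam_is i (Suc r))
        \<le> 1 / (2 * \<eta> * real K) * ((norm (x i r 0 - z))\<^sup>2 - (norm (x i (Suc r) 0 - z))\<^sup>2)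
          + (lam_is i (Suc r) - lam_opt i) \<bullet> (client_avg K x i r - z)"
        using client_round[OF pos assms(2) conv[OF i] coco[OF i] run(2)[OF i] client_avg_def run(3)[OF i], of z]
        by (simp add: D_def N_def w_def opt[OF i] run(1)[OF i])
    qed
    also have "\<dots> = (\<Sum>i=1..m. 1 / (2 * \<eta> * real K) * (norm (x i r 0 - z))\<^sup>2)
        - (\<Sum>i=1..m. 1 / (2 * \<eta> * real K) * (norm (x i (Suc r) 0 - z))\<^sup>2)
        + (\<Sum>i=1..m. (lam_is i (Suc r) - lam_opt i) \<bullet> (client_avg K x i r - z))"
      by (simp only: sum.distrib right_diff_distrib sum_subtractf)
    also have "(\<Sum>i=1..m. (lam_is i (Suc r) - lam_opt i) \<bullet> (client_avg K x i r - z))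
      = 1 / (4 * \<rho>) * ((\<Sum>i=1..m. (norm (\<rho> *\<^sub>R xs r - lam_si i r - (\<rho> *\<^sub>R z + lam_opt i)))\<^sup>2)
        - (\<Sum>i=1..m. (norm (\<rho> *\<^sub>R xs (Suc r) - lam_si i (Suc r) - (\<rho> *\<^sub>R z + lam_opt i)))\<^sup>2))"
      by (rule server_round[OF assms(1) pos(2) opt_sum run(3) server run(4)])
    finally show ?thesis
      unfolding \<Phi>_def right_diff_distrib by linarith
  qed

  have total: "(\<Sum>r=1..R. \<Sum>i=1..m. D i (client_avg K x i r) + N i (lam_is i (Suc r))) \<le> \<Phi> 1" for R
  proof -
    have "(\<Sum>r=1..R. \<Sum>i=1..m. D i (client_avg K x i r) + N i (lam_is i (Suc r)))
        \<le> (\<Sum>r=1..R. \<Phi> r - \<Phi> (Suc r))"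
      using round by (intro sum_mono) auto
    also have "\<dots> = \<Phi> 1 - \<Phi> (Suc R)" by (induction R) auto
    finally show ?thesis using \<Phi>_nonneg[of "Suc R"] by linarith
  qed
  have totalD: "(\<Sum>i=1..m. \<Sum>r=1..R. D i (client_avg K x i r)) \<le> \<Phi> 1"
    and totalN: "(\<Sum>i=1..m. \<Sum>r=1..R. N i (lam_is i (Suc r))) \<le> \<Phi> 1" for R
  proof -
    have "(\<Sum>i=1..m. \<Sum>r=1..R. D i (client_avg K x i r)) + (\<Sum>i=1..m. \<Sum>r=1..R. N i (lam_is i (Suc r))) \<le> \<Phi> 1"
      using total[of R] unfolding sum.distrib by (simp only: sum.swap[of _ "{1..R}" "{1..m}"])
    moreover have "0 \<le> (\<Sum>i=1..m. \<Sum>r=1..R. D i (client_avg K x i r))"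
      "0 \<le> (\<Sum>i=1..m. \<Sum>r=1..R. N i (lam_is i (Suc r)))"
      using D_nonneg N_nonneg by (auto intro!: sum_nonneg)
    ultimately show "(\<Sum>i=1..m. \<Sum>r=1..R. D i (client_avg K x i r)) \<le> \<Phi> 1"
      "(\<Sum>i=1..m. \<Sum>r=1..R. N i (lam_is i (Suc r))) \<le> \<Phi> 1" by linarith+
  qed

  \<comment> \<open>\<open>D i\<close> differs from \<open>f i\<close> by an affine function, so it
    is convex and Jensen applies over the rounds.\<close>
  have primal: "real R * D i (primal_avg K x i R) \<le> (\<Sum>r=1..R. D i (client_avg K x i r))"
    if "i \<in> {1..m}" "R \<ge> 1" for i R
  proof -
    have "convex_on UNIV (D i)"
    proof (rule convex_onI)
      fix t :: real and a b :: "real ^ 'd" assume t: "0 < t" "t < 1"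
      show "D i ((1 - t) *\<^sub>R a + t *\<^sub>R b) \<le> (1 - t) * D i a + t * D i b"
        using convex_onD[OF conv[OF that(1)], of t a b] t
        by (simp add: D_def inner_simps algebra_simps)
    qed simp
    from convex_on_mean[OF this that(2)] that(2) show ?thesis
      by (simp add: primal_avg_def field_simps)
  qed
  have dual: "real R * N i (dual_avg lam_is i R) \<le> (\<Sum>r=1..R. N i (lam_is i (Suc r)))"
    if "R \<ge> 1" for i R
  proof -
    have "dual_avg lam_is i R - lam_opt i = (1 / real R) *\<^sub>R (\<Sum>r=1..R. lam_is i (Suc r) - lam_opt i)"
      using that by (simp add: dual_avg_def sum_subtractf scaleR_diff_right sum_constant_scaleR del: sum_constant)
    then have "(norm (dual_avg lam_is i R - lam_opt i))\<^sup>2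
        \<le> (1 / real R) * (\<Sum>r=1..R. (norm (lam_is i (Suc r) - lam_opt i))\<^sup>2)"
      using convex_on_mean[OF convex_on_norm_power2 that, of "\<lambda>r. lam_is i (Suc r) - lam_opt i"] by simp
    then have "w * (norm (dual_avg lam_is i R - lam_opt i))\<^sup>2
        \<le> w * ((1 / real R) * (\<Sum>r=1..R. (norm (lam_is i (Suc r) - lam_opt i))\<^sup>2))"
      using w by (rule mult_left_mono)
    then show ?thesis
      using that unfolding N_def sum_distrib_left[symmetric] by (simp add: field_simps)
  qed

  \<comment> \<open>The summands differ by \<open>lam_opt i \<bullet> z\<close>; since
    \<open>z\<close> is common to all clients and the multipliers sum to zero, these terms cancel in
    the sum.\<close>
  have D_sum: "(\<Sum>i=1..m. f i (y i) - lam_opt i \<bullet> y i - f i (x_opt i)) = (\<Sum>i=1..m. D i (y i))" for y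
  proof -
    have "(\<Sum>i=1..m. f i (y i) - lam_opt i \<bullet> y i - f i (x_opt i))
        = (\<Sum>i=1..m. D i (y i) - lam_opt i \<bullet> z)"
      by (intro sum.cong) (auto simp: D_def opt(1) inner_diff_right)
    also have "\<dots> = (\<Sum>i=1..m. D i (y i))"
      using opt_sum by (simp add: sum_subtractf inner_sum_left[symmetric])
    finally show ?thesis .
  qed
  have "(\<lambda>R. \<Sum>i=1..m. D i (primal_avg K x i R)) \<in> O(\<lambda>R. 1 / real R)"
  proof (rule bigo_inverse_natI)
    fix R :: nat assume R: "R \<ge> 1"
    show "0 \<le> (\<Sum>i=1..m. D i (primal_avg K x i R))" using D_nonneg by (intro sum_nonneg) auto
    \<comment> \<open>The constant is \<open>\<Phi> 1\<close>, the value at the first round, which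
      does not depend on \<open>R\<close>.\<close>
    show "real R * (\<Sum>i=1..m. D i (primal_avg K x i R)) \<le> \<Phi> 1"
      unfolding sum_distrib_left using primal R by (intro order_trans[OF sum_mono totalD]) auto
  qed
  moreover have "(\<lambda>R. \<Sum>i=1..m. N i (dual_avg lam_is i R)) \<in> O(\<lambda>R. 1 / real R)"
  proof (rule bigo_inverse_natI)
    fix R :: nat assume R: "R \<ge> 1"
    show "0 \<le> (\<Sum>i=1..m. N i (dual_avg lam_is i R))" using N_nonneg by (intro sum_nonneg) auto
    show "real R * (\<Sum>i=1..m. N i (dual_avg lam_is i R)) \<le> \<Phi> 1"
      unfolding sum_distrib_left using dual R by (intro order_trans[OF sum_mono totalN]) auto
  qed
  ultimately show ?thesis unfolding D_sum N_def w_def by simp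
qed

end
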